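(* Let $T\in\mathcal{B}^{0,1}(V_n)$, suppose that $B\in\mathcal{B}(V_n)$ commutes with $T$, and let $s,q\in\rho_S(T)$ with $q\notin[s]$. Then $$S_R^{-1}(s,T)BS_L^{-1}(q,T)=\Big[\big(S_R^{-1}(s,T)B-BS_L^{-1}(q,T)\big)q-\overline{s}\big(S_R^{-1}(s,T)B-BS_L^{-1}(q,T)\big)\Big]\mathcal{Q}_s(q)^{-1}.$$ Equivalently, $$S_R^{-1}(s,T)BS_L^{-1}(q,T)=\mathcal{Q}_q(s)^{-1}\Big[\big(BS_L^{-1}(q,T)-S_R^{-1}(s,T)B\big)\overline{q}-s\big(BS_L^{-1}(q,T)-S_R^{-1}(s,T)B\big)\Big].$$ Here $\mathcal{Q}_s(q)=q^2-2\mathrm{Re}(s)q+|s|^2$.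
   Context: $\mathbb{R}_n$ is the real Clifford algebra generated by $e_1,\dots,e_n$ with $e_\ell e_m+e_me_\ell=0$ ($\ell\ne m$), $e_\ell^2=-1$, with basis $e_A$. A point of $\mathbb{R}^{n+1}$ is identified with the paravector $s=s_0+\underline{s}=s_0+\sum_{\ell=1}^n s_\ell e_\ell$; $\mathrm{Re}(s)=s_0$, $\overline{s}=s_0-\underline{s}$, $|s|^2=\sum_{\ell=0}^ns_\ell^2$. $\mathbb{S}=\{\sum_{\ell=1}^n x_\ell e_\ell:\sum x_\ell^2=1\}$ and $[s]=\{s_0+\mathrm{j}|\underline{s}|:\mathrm{j}\in\mathbb{S}\}$. $V$ is a real Banach space, $V_n=V\otimes\mathbb{R}_n$ with elements $\sum_Av_Ae_A$ and $\|v\|^2=\sum_A\|v_A\|^2$, a two-sided $\mathbb{R}_n$-module. $\mathcal{B}(V_n)$ is the set of Clifford operators $T=\sum_Ae_AT_A$, $T_A$ bounded linear on $V$, acting by $T(\sum_B v_Be_B)=\sum_{A,B}T_A(v_B)e_Ae_B$; for $a\in\mathbb{R}_n$, $(aT)(v)=a\,T(v)$, $(Ta)(v)=T(av)$. $\mathcal{B}^{0,1}(V_n)$ is the set of paravector operators $T=T_0+\sum_{j=1}^ne_jT_j$. For $s\in\mathbb{R}^{n+1}$: $\mathcal{Q}_s(T)=T^2-2\mathrm{Re}(s)T+|s|^2\mathcal{I}$; $\rho_S(T)=\{s\in\mathbb{R}^{n+1}:\mathcal{Q}_s(T)\text{ invertible in }\mathcal{B}(V_n)\}$. For $s\in\rho_S(T)$: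 $S_L^{-1}(s,T)=-\mathcal{Q}_s(T)^{-1}(T-\overline{s}\mathcal{I})$, $S_R^{-1}(s,T)=-(T-\overline{s}\mathcal{I})\mathcal{Q}_s(T)^{-1}$.
   Formalization: The second displayed formula is false as printed (T=0, B=I, s=1, q=2 gives 1/2 on the left, -1/2 on the right); it is stated and proved with a minus sign in front of its right-hand side. The first formula is as printed. *)

theory Defs
  imports "HOL-Analysis.Analysis"
begin

section \<open>The real Clifford algebra\<close>

text \<open>
  The generators are indexed by a finite linearly ordered type \<open>'n\<close>, so that \<open>n = CARD('n)\<close>.
  An element \<open>\<Sum>\<^sub>A a\<^sub>A e\<^sub>A\<close> is stored as its family of coefficients
  \<open>a\<^sub>A\<close>, where \<open>A\<close> ranges over the subsets of \<open>'n\<close>.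
\<close>

typedef 'n clifford = "UNIV :: ('n set \<Rightarrow> real) set"
  morphisms cl_coeff Cliff ..

lemma cl_coeff_Cliff [simp]: "cl_coeff (Cliff f) = f"
  by (simp add: Cliff_inverse)

lemma clifford_eqI: "(\<And>A. cl_coeff x A = cl_coeff y A) \<Longrightarrow> x = y"
  by (metis cl_coeff_inverse ext)

text \<open>
  \<open>e\<^sub>A e\<^sub>B = \<plusminus> e\<^sub>C\<close> where \<open>C\<close> is the symmetric difference of \<open>A\<close> and \<open>B\<close>. Sorting the word
  needs one sign for every pair \<open>b < a\<close> with \<open>a \<in> A\<close>, \<open>b \<in> B\<close>, and every common index \<open>a = b\<close>
  gives one further sign because \<open>e\<^sub>a\<^sup>2 = -1\<close>.
\<close>

definition blade_sign :: "'n::{finite,linorder} set \<Rightarrow> 'n set \<Rightarrow> real" where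
  "blade_sign A B = (- 1) ^ card {(a, b). a \<in> A \<and> b \<in> B \<and> b \<le> a}"

lemma minus_one_power_card_sym_diff:
  assumes "finite X" "finite Y"
  shows "(- 1 :: real) ^ card (sym_diff X Y) = (- 1) ^ card X * (- 1) ^ card Y"
proof -
  have "card (sym_diff X Y) = card (X - Y) + card (Y - X)"
    using assms by (intro card_Un_disjoint) auto
  moreover have "card X = card (X - Y) + card (X \<inter> Y)"
    using assms by (metis add.commute card_Int_Diff)
  moreover have "card Y = card (Y - X) + card (X \<inter> Y)"
    using assms by (metis add.commute card_Int_Diff inf_commute)
  ultimately have "card X + card Y = card (sym_diff X Y) + 2 * card (X \<inter> Y)"
    by simp
  then have "(- 1 :: real) ^ (card X + card Y) = (- 1) ^ card (sym_diff X Y)"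
    by (simp add: power_add power_mult)
  then show ?thesis
    by (simp add: power_add)
qed

lemma blade_sign_sym_diff_left:
  "blade_sign (sym_diff A B) C = blade_sign A C * blade_sign B C"
proof -
  have "{(a, b). a \<in> sym_diff A B \<and> b \<in> C \<and> b \<le> a} =
      sym_diff {(a, b). a \<in> A \<and> b \<in> C \<and> b \<le> a} {(a, b). a \<in> B \<and> b \<in> C \<and> b \<le> a}"
    by auto
  then show ?thesis
    unfolding blade_sign_def by (simp only: minus_one_power_card_sym_diff[OF finite finite])
qed

lemma blade_sign_sym_diff_right:
  "blade_sign A (sym_diff B C) = blade_sign A B * blade_sign A C"
proof -
  have "{(a, b). a \<in> A \<and> b \<in> sym_diff B C \<and> b \<le> a} =
      sym_diff {(a, b). a \<in> A \<and> b \<in> B \<and> b \<le> a} {(a, b). a \<in> A \<and> b \<in> C \<and> b \<le> a}"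
    by auto
  then show ?thesis
    unfolding blade_sign_def by (simp only: minus_one_power_card_sym_diff[OF finite finite])
qed

lemma blade_sign_empty [simp]: "blade_sign {} A = 1" "blade_sign A {} = 1"
  by (simp_all add: blade_sign_def)

instantiation clifford :: ("{finite,linorder}") "{real_vector,times,one}"
begin

definition "0 = Cliff (\<lambda>A. 0)"
definition "1 = Cliff (\<lambda>A. if A = {} then 1 else 0)"
definition "x + y = Cliff (\<lambda>A. cl_coeff x A + cl_coeff y A)"
definition "x - y = Cliff (\<lambda>A. cl_coeff x A - cl_coeff y A)"
definition "- x = Cliff (\<lambda>A. - cl_coeff x A)"
definition "r *\<^sub>R x = Cliff (\<lambda>A. r * cl_coeff x A)"
definition "x * y = Cliff (\<lambda>C. \<Sum>(A, B) | sym_diff A B = C.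
  blade_sign A B * cl_coeff x A * cl_coeff y B)"

instance
  by standard
    (auto simp: zero_clifford_def plus_clifford_def minus_clifford_def uminus_clifford_def
      scaleR_clifford_def algebra_simps intro!: clifford_eqI)

end

lemma cl_coeff_simps [simp]:
  "cl_coeff 0 A = 0"
  "cl_coeff 1 A = (if A = {} then 1 else 0)"
  "cl_coeff (x + y) A = cl_coeff x A + cl_coeff y A"
  "cl_coeff (x - y) A = cl_coeff x A - cl_coeff y A"
  "cl_coeff (- x) A = - cl_coeff x A"
  "cl_coeff (r *\<^sub>R x) A = r * cl_coeff x A"
  by (simp_all add: zero_clifford_def one_clifford_def plus_clifford_def minus_clifford_def
      uminus_clifford_def scaleR_clifford_def)

lemma cl_coeff_sum: "cl_coeff (sum f S) A = (\<Sum>i\<in>S. cl_coeff (f i) A)"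
  by (induction S rule: infinite_finite_induct) auto

lemma sym_diff_cancel: "sym_diff A (sym_diff A B) = B"
  by auto

lemma cl_coeff_times:
  "cl_coeff (x * y) C =
    (\<Sum>A\<in>UNIV. blade_sign A (sym_diff A C) * cl_coeff x A * cl_coeff y (sym_diff A C))"
  unfolding times_clifford_def cl_coeff_Cliff
proof (rule sum.reindex_bij_witness[where i = "\<lambda>A. (A, sym_diff A C)" and j = fst], goal_cases)
  case (1 a)
  then show ?case
    by (auto simp only: sym_diff_cancel mem_Collect_eq case_prod_conv fst_conv split: prod.splits)
next
  case (4 a)
  then show ?case
    by (auto simp only: sym_diff_cancel mem_Collect_eq case_prod_conv)
next
  case (5 a)
  then show ?case
    by (auto simp only: sym_diff_cancel mem_Collect_eq case_prod_conv fst_conv split: prod.splits)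
qed simp_all

instance clifford :: ("{finite,linorder}") real_algebra_1
proof
  fix x y z :: "'a clifford" and r :: real
  show "x * y * z = x * (y * z)"
  proof (rule clifford_eqI)
    fix D
    let ?f = "\<lambda>A C. blade_sign C (sym_diff C D) * (blade_sign A (sym_diff A C)
      * cl_coeff x A * cl_coeff y (sym_diff A C)) * cl_coeff z (sym_diff C D)"
    have sgn: "blade_sign A (sym_diff A D) * blade_sign (sym_diff A C) (sym_diff C D)
        = blade_sign C (sym_diff C D) * blade_sign A (sym_diff A C)" for A C :: "'a set"
    proof -
      have "sym_diff A D = sym_diff (sym_diff A C) (sym_diff C D)"
        by auto
      then have "blade_sign A (sym_diff A D)
          = blade_sign A (sym_diff A C) * blade_sign A (sym_diff C D)"
        by (simp only: blade_sign_sym_diff_right)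
      moreover have "blade_sign C (sym_diff C D)
          = blade_sign A (sym_diff C D) * blade_sign (sym_diff A C) (sym_diff C D)"
        by (metis blade_sign_sym_diff_left sym_diff_cancel)
      ultimately show ?thesis
        by simp
    qed
    have inner: "(\<Sum>B\<in>UNIV. blade_sign A (sym_diff A D) * cl_coeff x A *
        (blade_sign B (sym_diff B (sym_diff A D)) * cl_coeff y B
          * cl_coeff z (sym_diff B (sym_diff A D)))) = (\<Sum>C\<in>UNIV. ?f A C)" for A
    proof (rule sum.reindex_bij_witness[where i = "\<lambda>C. sym_diff A C" and j = "\<lambda>B. sym_diff A B"])
      fix B :: "'a set"
      have e1: "sym_diff A (sym_diff A B) = B"
        by (rule sym_diff_cancel)
      have e2: "sym_diff (sym_diff A B) D = sym_diff B (sym_diff A D)"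
        by auto
      show "?f A (sym_diff A B) = blade_sign A (sym_diff A D) * cl_coeff x A *
        (blade_sign B (sym_diff B (sym_diff A D)) * cl_coeff y B
          * cl_coeff z (sym_diff B (sym_diff A D)))"
        using sgn[of A "sym_diff A B"] unfolding e1 e2 by algebra
    qed auto
    have "cl_coeff (x * y * z) D = (\<Sum>C\<in>UNIV. \<Sum>A\<in>UNIV. ?f A C)"
      by (simp only: cl_coeff_times sum_distrib_left sum_distrib_right)
    also have "\<dots> = (\<Sum>A\<in>UNIV. \<Sum>C\<in>UNIV. ?f A C)"
      by (rule sum.swap)
    also have "\<dots> = cl_coeff (x * (y * z)) D"
      by (simp only: cl_coeff_times sum_distrib_left sum_distrib_right inner)
    finally show "cl_coeff (x * y * z) D = cl_coeff (x * (y * z)) D" .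
  qed
  show "1 * x = x"
  proof (rule clifford_eqI)
    fix A
    have "cl_coeff (1 * x) A = (\<Sum>B\<in>(UNIV :: 'a set set). if B = {} then cl_coeff x A else 0)"
      unfolding cl_coeff_times by (rule sum.cong) auto
    then show "cl_coeff (1 * x) A = cl_coeff x A"
      by simp
  qed
  show "x * 1 = x"
  proof (rule clifford_eqI)
    fix A
    have "cl_coeff (x * 1) A = (\<Sum>B\<in>UNIV. if B = A then cl_coeff x A else 0)"
      unfolding cl_coeff_times
    proof (rule sum.cong[OF refl])
      fix B
      have "sym_diff B A = {} \<longleftrightarrow> B = A"
        by auto
      then show "blade_sign B (sym_diff B A) * cl_coeff x B * cl_coeff 1 (sym_diff B A)
          = (if B = A then cl_coeff x A else 0)"
        by (cases "B = A") auto
    qed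
    then show "cl_coeff (x * 1) A = cl_coeff x A"
      by simp
  qed
  show "(x + y) * z = x * z + y * z" "x * (y + z) = x * y + x * z"
    by (rule clifford_eqI, simp add: cl_coeff_times algebra_simps sum.distrib)+
  show "r *\<^sub>R x * y = r *\<^sub>R (x * y)" "x * r *\<^sub>R y = r *\<^sub>R (x * y)"
    by (rule clifford_eqI, simp add: cl_coeff_times sum_distrib_left ac_simps)+
  show "(0 :: 'a clifford) \<noteq> 1"
    by (metis cl_coeff_simps(1,2) zero_neq_one)
qed

definition blade :: "'n::{finite,linorder} set \<Rightarrow> 'n clifford" where
  "blade A = Cliff (\<lambda>B. if B = A then 1 else 0)"

abbreviation gen :: "'n::{finite,linorder} \<Rightarrow> 'n clifford" where
  "gen l \<equiv> blade {l}"

lemma cl_coeff_blade [simp]: "cl_coeff (blade A) B = (if B = A then 1 else 0)"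
  by (simp add: blade_def)

lemma blade_empty: "blade {} = 1"
  by (rule clifford_eqI) simp

lemma clifford_expand: "x = (\<Sum>A\<in>UNIV. cl_coeff x A *\<^sub>R blade A)"
  by (rule clifford_eqI) (simp add: cl_coeff_sum if_distrib[of "\<lambda>u. _ * u"] cong: if_cong)

lemma blade_times: "blade A * blade B = blade_sign A B *\<^sub>R blade (sym_diff A B)"
proof (rule clifford_eqI)
  fix C
  have "cl_coeff (blade A * blade B) C =
      (\<Sum>D\<in>UNIV. if D = A then (if sym_diff A C = B then blade_sign A B else 0) else 0)"
    unfolding cl_coeff_times by (rule sum.cong) auto
  also have "\<dots> = (if sym_diff A C = B then blade_sign A B else 0)"
    by simp
  also have "\<dots> = cl_coeff (blade_sign A B *\<^sub>R blade (sym_diff A B)) C"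
    using sym_diff_cancel[of A B] sym_diff_cancel[of A C] by auto
  finally show "cl_coeff (blade A * blade B) C = \<dots>" .
qed

lemma gen_square: "gen l * gen l = - 1"
proof -
  have "{(a, b). a \<in> {l} \<and> b \<in> {l} \<and> b \<le> a} = {(l, l)}"
    by auto
  then show ?thesis
    by (simp add: blade_times blade_sign_def blade_empty)
qed

lemma gen_anticommute:
  assumes "l \<noteq> m"
  shows "gen l * gen m + gen m * gen l = 0"
proof -
  have *: "gen a * gen b + gen b * gen a = 0" if "a < b" for a b :: 'a
  proof -
    have "{(x, y). x \<in> {a} \<and> y \<in> {b} \<and> y \<le> x} = {}"
      "{(x, y). x \<in> {b} \<and> y \<in> {a} \<and> y \<le> x} = {(b, a)}"
      using that by auto
    moreover have "sym_diff {a} {b} = {a, b}" "sym_diff {b} {a} = {a, b}"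
      using that by auto
    ultimately show ?thesis
      by (simp only: blade_times blade_sign_def) simp
  qed
  show ?thesis
    using assms *[of l m] *[of m l] by (cases l m rule: linorder_cases) (auto simp: add.commute)
qed

lemma blade_insert:
  assumes "\<And>a. a \<in> A \<Longrightarrow> l < a"
  shows "blade (insert l A) = gen l * blade A"
proof -
  have "{(x, y). x \<in> {l} \<and> y \<in> A \<and> y \<le> x} = {}" "sym_diff {l} A = insert l A"
    using assms by (auto simp: not_le)
  then show ?thesis
    by (simp only: blade_times blade_sign_def) simp
qed


section \<open>Paravectors\<close>

definition paravectors :: "'n::{finite,linorder} clifford set" where
  "paravectors = {of_real x0 + (\<Sum>l\<in>UNIV. x l *\<^sub>R gen l) | x0 x. True}"

text \<open>The following functions are meant for paravectors only.\<close>

definition para_re :: "'n::{finite,linorder} clifford \<Rightarrow> real" where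
  "para_re s = cl_coeff s {}"

definition para_vec :: "'n::{finite,linorder} clifford \<Rightarrow> 'n clifford" where
  "para_vec s = (\<Sum>l\<in>UNIV. cl_coeff s {l} *\<^sub>R gen l)"

definition para_conj :: "'n::{finite,linorder} clifford \<Rightarrow> 'n clifford" where
  "para_conj s = of_real (para_re s) - para_vec s"

definition para_norm :: "'n::{finite,linorder} clifford \<Rightarrow> real" where
  "para_norm s = sqrt ((cl_coeff s {})\<^sup>2 + (\<Sum>l\<in>UNIV. (cl_coeff s {l})\<^sup>2))"

definition unit_sphere :: "'n::{finite,linorder} clifford set" where
  "unit_sphere = {\<Sum>l\<in>UNIV. x l *\<^sub>R gen l | x. (\<Sum>l\<in>UNIV. (x l)\<^sup>2) = 1}"

definition para_class :: "'n::{finite,linorder} clifford \<Rightarrow> 'n clifford set" where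
  "para_class s = {of_real (para_re s) + para_norm (para_vec s) *\<^sub>R j | j. j \<in> unit_sphere}"

definition Q_para :: "'n::{finite,linorder} clifford \<Rightarrow> 'n clifford \<Rightarrow> 'n clifford" where
  "Q_para s q = q\<^sup>2 - (2 * para_re s) *\<^sub>R q + of_real ((para_norm s)\<^sup>2)"

definition cl_inverse :: "'n::{finite,linorder} clifford \<Rightarrow> 'n clifford" where
  "cl_inverse a = (THE b. a * b = 1 \<and> b * a = 1)"


section \<open>Clifford modules and Clifford operators\<close>

text \<open>
  An element \<open>\<Sum>\<^sub>A v\<^sub>A e\<^sub>A\<close> of \<open>V \<otimes> \<real>\<^sub>n\<close> is the vector of its components \<open>v\<^sub>A\<close>. The norm of the type
  \<open>vec\<close> is the Euclidean one, that is \<open>\<parallel>v\<parallel>\<^sup>2 = \<Sum>\<^sub>A \<parallel>v\<^sub>A\<parallel>\<^sup>2\<close>.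
\<close>

type_synonym ('v, 'n) clmod = "('v, 'n set) vec"
type_synonym ('v, 'n) clmap = "('v, 'n) clmod \<Rightarrow>\<^sub>L ('v, 'n) clmod"

definition cl_tensor :: "'v::real_vector \<Rightarrow> 'n::{finite,linorder} clifford \<Rightarrow> ('v, 'n) clmod" where
  "cl_tensor v a = (\<chi> A. cl_coeff a A *\<^sub>R v)"

definition cl_act :: "'n::{finite,linorder} clifford \<Rightarrow> ('v::real_vector, 'n) clmod \<Rightarrow> ('v, 'n) clmod" where
  "cl_act a w = (\<Sum>A\<in>UNIV. cl_tensor (w $ A) (a * blade A))"

lemma bounded_linear_cl_tensor:
  fixes f :: "'a::real_normed_vector \<Rightarrow> 'v::real_normed_vector"
  assumes "bounded_linear f"
  shows "bounded_linear (\<lambda>w. cl_tensor (f w) a)"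
proof -
  interpret f: bounded_linear f by fact
  have "bounded_linear (\<lambda>v::'v. cl_tensor v a)"
  proof (rule bounded_linear_intro[where K = "\<Sum>A\<in>UNIV. \<bar>cl_coeff a A\<bar>"])
    fix x y :: 'v and r :: real
    show "cl_tensor (x + y) a = cl_tensor x a + cl_tensor y a"
      "cl_tensor (r *\<^sub>R x) a = r *\<^sub>R cl_tensor x a"
      by (simp_all add: cl_tensor_def vec_eq_iff scaleR_add_right)
    have "norm (cl_tensor x a) \<le> (\<Sum>A\<in>UNIV. norm (cl_tensor x a $ A))"
      unfolding norm_vec_def by (rule L2_set_le_sum) simp
    then show "norm (cl_tensor x a) \<le> norm x * (\<Sum>A\<in>UNIV. \<bar>cl_coeff a A\<bar>)"
      by (simp add: cl_tensor_def sum_distrib_left ac_simps)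
  qed
  from bounded_linear_compose[OF this assms] show ?thesis .
qed

lemma bounded_linear_cl_act:
  "bounded_linear (cl_act a :: ('v::real_normed_vector, 'n::{finite,linorder}) clmod \<Rightarrow> _)"
  unfolding cl_act_def
  by (intro bounded_linear_sum bounded_linear_cl_tensor bounded_linear_vec_nth)

definition clifford_op ::
  "('n::{finite,linorder} set \<Rightarrow> 'v::banach \<Rightarrow>\<^sub>L 'v) \<Rightarrow> ('v, 'n) clmap" where
  "clifford_op F =
    Blinfun (\<lambda>v. \<Sum>A\<in>UNIV. \<Sum>B\<in>UNIV. cl_tensor (F A (v $ B)) (blade A * blade B))"

lemma clifford_op_apply:
  "clifford_op F v = (\<Sum>A\<in>UNIV. \<Sum>B\<in>UNIV. cl_tensor (F A (v $ B)) (blade A * blade B))"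
proof -
  have "bounded_linear (\<lambda>v. \<Sum>A\<in>UNIV. \<Sum>B\<in>UNIV. cl_tensor (F A (v $ B)) (blade A * blade B))"
    by (intro bounded_linear_sum bounded_linear_cl_tensor blinfun.bounded_linear_right
        bounded_linear_compose[OF blinfun.bounded_linear_right] bounded_linear_vec_nth)
  then show ?thesis
    by (simp add: clifford_op_def bounded_linear_Blinfun_apply)
qed

definition clifford_ops :: "('v::banach, 'n::{finite,linorder}) clmap set" where
  "clifford_ops = range clifford_op"

definition paravector_ops :: "('v::banach, 'n::{finite,linorder}) clmap set" where
  "paravector_ops = {clifford_op F | F. \<forall>A. card A \<ge> 2 \<longrightarrow> F A = 0}"

definition cl_op_left ::
  "'n::{finite,linorder} clifford \<Rightarrow> ('v::banach, 'n) clmap \<Rightarrow> ('v, 'n) clmap" where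
  "cl_op_left a T = Blinfun (\<lambda>v. cl_act a (T v))"

definition cl_op_right ::
  "('v::banach, 'n) clmap \<Rightarrow> 'n::{finite,linorder} clifford \<Rightarrow> ('v, 'n) clmap" where
  "cl_op_right T a = Blinfun (\<lambda>v. T (cl_act a v))"

lemma cl_op_left_apply: "cl_op_left a T v = cl_act a (T v)"
  by (simp add: cl_op_left_def bounded_linear_Blinfun_apply
      bounded_linear_compose[OF bounded_linear_cl_act blinfun.bounded_linear_right])

lemma cl_op_right_apply: "cl_op_right T a v = T (cl_act a v)"
  by (simp add: cl_op_right_def bounded_linear_Blinfun_apply
      bounded_linear_compose[OF blinfun.bounded_linear_right bounded_linear_cl_act])


section \<open>The S-functional calculus\<close>

definition clop_invertible :: "('v::banach, 'n::{finite,linorder}) clmap \<Rightarrow> bool" where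
  "clop_invertible T \<longleftrightarrow>
    (\<exists>S\<in>clifford_ops. S o\<^sub>L T = id_blinfun \<and> T o\<^sub>L S = id_blinfun)"

definition clop_inverse :: "('v::banach, 'n::{finite,linorder}) clmap \<Rightarrow> ('v, 'n) clmap" where
  "clop_inverse T =
    (THE S. S \<in> clifford_ops \<and> S o\<^sub>L T = id_blinfun \<and> T o\<^sub>L S = id_blinfun)"

text \<open>The infix \<open>o\<^sub>L\<close> binds more weakly than addition and subtraction.\<close>

definition Q_op ::
  "'n::{finite,linorder} clifford \<Rightarrow> ('v::banach, 'n) clmap \<Rightarrow> ('v, 'n) clmap" where
  "Q_op s T = (T o\<^sub>L T) - (2 * para_re s) *\<^sub>R T + (para_norm s)\<^sup>2 *\<^sub>R id_blinfun"

definition S_resolvent_set ::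
  "('v::banach, 'n::{finite,linorder}) clmap \<Rightarrow> 'n clifford set" where
  "S_resolvent_set T = {s \<in> paravectors. clop_invertible (Q_op s T)}"

definition S_L_inv ::
  "'n::{finite,linorder} clifford \<Rightarrow> ('v::banach, 'n) clmap \<Rightarrow> ('v, 'n) clmap" where
  "S_L_inv s T = - (clop_inverse (Q_op s T) o\<^sub>L (T - cl_op_left (para_conj s) id_blinfun))"

definition S_R_inv ::
  "'n::{finite,linorder} clifford \<Rightarrow> ('v::banach, 'n) clmap \<Rightarrow> ('v, 'n) clmap" where
  "S_R_inv s T = - ((T - cl_op_left (para_conj s) id_blinfun) o\<^sub>L clop_inverse (Q_op s T))"

end

theory Submission
  imports Defs
begin

text \<open>
  Left multiplication by Clifford numbers embeds \<open>\<real>\<^sub>n\<close> as a unital subalgebra \<open>a \<mapsto> L\<^sub>a\<close> of the bounded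
  operators on \<open>V\<^sub>n\<close>, and then \<open>aT = L\<^sub>a T\<close> and \<open>Ta = T L\<^sub>a\<close>. So both formulas are identities in an
  associative algebra in which \<open>T\<close> need not commute with the scalars \<open>s\<close> and \<open>q\<close>.

  Since \<open>s + s\<^sup>*\<close> and \<open>s s\<^sup>*\<close> are real for a paravector \<open>s\<close> with conjugate \<open>s\<^sup>*\<close>, the operators
  \<open>s (T - s\<^sup>*) - (T - s\<^sup>*) T\<close> and \<open>(T - s\<^sup>*) s - T (T - s\<^sup>*)\<close> both collapse to \<open>- Q\<^sub>s(T)\<close>. As \<open>T\<close>
  commutes with \<open>Q\<^sub>s(T)\<^sup>-\<^sup>1\<close>, this gives the resolvent equations
  \<open>s R - R T = 1\<close> for \<open>R = S\<^sub>R\<^sup>-\<^sup>1(s,T)\<close> and \<open>L q - T L = 1\<close> for \<open>L = S\<^sub>L\<^sup>-\<^sup>1(q,T)\<close>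
  (\<open>right_S_resolvent_equation\<close>, \<open>left_S_resolvent_equation\<close>). Put \<open>X = R B L\<close>. Because \<open>B\<close> commutes
  with \<open>T\<close>, the operator \<open>R B T L = R T B L\<close> can be evaluated by either equation, and comparison
  yields \<open>D = R B - B L = X q - s X\<close> (\<open>S_resolvent_product_sylvester\<close>). This is a Sylvester
  equation for \<open>X\<close>. Multiplying once more by scalars,
  \<open>D q - s\<^sup>* D = X (q\<^sup>2 - 2 Re(s) q + \<bar>s\<bar>\<^sup>2) = X Q\<^sub>s(q)\<close>, and symmetrically
  \<open>s D - D q\<^sup>* = - Q\<^sub>q(s) X\<close> (\<open>sylvester_solution\<close>).

  It remains to divide by \<open>Q\<^sub>s(q)\<close> and \<open>Q\<^sub>q(s)\<close>. Both are paravectors, since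
  \<open>q\<^sup>2 = 2 Re(q) q - \<bar>q\<bar>\<^sup>2\<close>, so they are invertible unless they vanish; and they vanish only if \<open>s\<close>
  and \<open>q\<close> have equal real parts and equally long vector parts, that is, if \<open>q \<in> [s]\<close>.
\<close>


section \<open>Inverting \<open>Q\<^sub>s(q)\<close>\<close>

lemma cl_coeff_of_real [simp]: "cl_coeff (of_real r) A = (if A = {} then r else 0)"
  by (simp add: of_real_def)

lemma cl_coeff_sum_gen [simp]:
  fixes x :: "'n::{finite,linorder} \<Rightarrow> real"
  shows "cl_coeff (\<Sum>l\<in>UNIV. x l *\<^sub>R gen l) {} = 0"
    and "cl_coeff (\<Sum>l\<in>UNIV. x l *\<^sub>R gen l) {m} = x m"
  by (simp_all add: cl_coeff_sum if_distrib[of "\<lambda>u. _ * u"] cong: if_cong)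

lemma paravector_decomp:
  assumes "s \<in> paravectors"
  shows "of_real (para_re s) + para_vec s = s"
  using assms by (auto simp: paravectors_def para_re_def para_vec_def)

lemma paravectorI: "of_real r + (\<Sum>l\<in>UNIV. x l *\<^sub>R gen l) \<in> paravectors"
  by (auto simp: paravectors_def)

lemma paravectors_add_real:
  assumes "s \<in> paravectors"
  shows "c *\<^sub>R s + of_real r \<in> paravectors"
proof -
  have "c *\<^sub>R (of_real (para_re s) + para_vec s) + of_real r = of_real (c * para_re s + r)
      + (\<Sum>l\<in>UNIV. (c * cl_coeff s {l}) *\<^sub>R gen l)"
    by (simp add: para_vec_def of_real_def scaleR_add_right scaleR_add_left scaleR_sum_right)
  then have "c *\<^sub>R s + of_real r = of_real (c * para_re s + r)
      + (\<Sum>l\<in>UNIV. (c * cl_coeff s {l}) *\<^sub>R gen l)"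
    using paravector_decomp[OF assms] by simp
  then show ?thesis
    by (simp only: paravectorI)
qed

lemma para_norm_square: "(para_norm s)\<^sup>2 = (para_re s)\<^sup>2 + (\<Sum>l\<in>UNIV. (cl_coeff s {l})\<^sup>2)"
  unfolding para_norm_def para_re_def by (simp add: sum_nonneg)

lemma para_norm_para_vec_square: "(para_norm (para_vec s))\<^sup>2 = (\<Sum>l\<in>UNIV. (cl_coeff s {l})\<^sup>2)"
  by (simp add: para_norm_square para_re_def para_vec_def)

text \<open>
  Averaging the double sum with its transpose leaves only the anticommutators of the generators, and
  these vanish off the diagonal.
\<close>

lemma para_vec_square: "para_vec s * para_vec s = - of_real ((para_norm (para_vec s))\<^sup>2)"
proof -
  let ?c = "\<lambda>l. cl_coeff s {l}"
  have expand: "para_vec s * para_vec s = (\<Sum>l\<in>UNIV. \<Sum>m\<in>UNIV. (?c l * ?c m) *\<^sub>R (gen l * gen m))"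
    unfolding para_vec_def sum_product by (intro sum.cong refl) (simp add: mult.commute)
  also have "\<dots> = (\<Sum>m\<in>UNIV. \<Sum>l\<in>UNIV. (?c l * ?c m) *\<^sub>R (gen l * gen m))"
    by (rule sum.swap)
  also have "\<dots> = (\<Sum>l\<in>UNIV. \<Sum>m\<in>UNIV. (?c l * ?c m) *\<^sub>R (gen m * gen l))"
    by (intro sum.cong refl arg_cong2[where f = scaleR] mult.commute)
  finally have "2 *\<^sub>R (para_vec s * para_vec s)
      = (\<Sum>l\<in>UNIV. \<Sum>m\<in>UNIV. (?c l * ?c m) *\<^sub>R (gen l * gen m + gen m * gen l))"
    using expand by (simp only: scaleR_2 scaleR_add_right sum.distrib)
  also have "\<dots> = (\<Sum>l\<in>UNIV. \<Sum>m\<in>UNIV. if m = l then (?c l)\<^sup>2 *\<^sub>R (- 2 :: 'a clifford) else 0)"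
    by (intro sum.cong refl) (auto simp: gen_anticommute gen_square power2_eq_square)
  also have "\<dots> = 2 *\<^sub>R (- of_real ((para_norm (para_vec s))\<^sup>2))"
    by (simp add: para_norm_para_vec_square scaleR_conv_of_real mult_2 mult_2_right
        sum.distrib sum_subtractf sum_negf)
  finally show ?thesis
    by (rule scaleR_left_imp_eq[rotated]) simp
qed

lemma para_conj_paravector:
  assumes "s \<in> paravectors"
  shows "para_conj s = of_real (2 * para_re s) - s"
proof -
  have "para_conj s + (of_real (para_re s) + para_vec s) = of_real (2 * para_re s)"
    unfolding para_conj_def mult_2 of_real_add by simp
  then have "para_conj s + s = of_real (2 * para_re s)"
    unfolding paravector_decomp[OF assms] .
  then show ?thesis
    by (rule eq_diff_eq[THEN iffD2])
qed

lemma para_mult_conj: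
  assumes "s \<in> paravectors"
  shows "s * para_conj s = of_real ((para_norm s)\<^sup>2)"
proof -
  let ?r = "of_real (para_re s) :: 'a clifford" and ?v = "para_vec s"
  have comm: "?v * ?r = ?r * ?v"
    by (simp add: of_real_def)
  have "(?r + ?v) * para_conj s = ?r * ?r - ?v * ?v"
    unfolding para_conj_def ring_distribs comm by simp
  also have "\<dots> = of_real ((para_norm s)\<^sup>2)"
    by (simp add: para_vec_square para_norm_square[of s] flip: para_norm_para_vec_square)
      (simp add: power2_eq_square)
  finally show ?thesis
    unfolding paravector_decomp[OF assms] .
qed

lemma para_conj_mult:
  assumes "s \<in> paravectors"
  shows "para_conj s * s = of_real ((para_norm s)\<^sup>2)"
  using para_mult_conj[OF assms]
  by (simp add: para_conj_paravector[OF assms] algebra_simps of_real_def)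

lemma paravector_square:
  assumes "s \<in> paravectors"
  shows "s\<^sup>2 = (2 * para_re s) *\<^sub>R s - of_real ((para_norm s)\<^sup>2)"
  using para_mult_conj[OF assms]
  by (simp add: para_conj_paravector[OF assms] algebra_simps of_real_def power2_eq_square)

lemma cl_inverse_eqI:
  assumes "a * b = 1" "b * a = 1"
  shows "cl_inverse a = b"
  unfolding cl_inverse_def
proof (rule the_equality)
  fix c
  assume "a * c = 1 \<and> c * a = 1"
  then show "c = b"
    using assms by (metis mult.assoc mult_1_left mult_1_right)
qed (use assms in simp)

lemma paravector_cl_inverse:
  assumes "s \<in> paravectors" "para_norm s \<noteq> 0"
  shows "s * cl_inverse s = 1" "cl_inverse s * s = 1"
proof -
  let ?b = "inverse ((para_norm s)\<^sup>2) *\<^sub>R para_conj s"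
  have b: "s * ?b = 1" "?b * s = 1"
    using assms by (simp_all add: para_mult_conj para_conj_mult of_real_def)
  then show "s * cl_inverse s = 1" "cl_inverse s * s = 1"
    by (simp_all only: cl_inverse_eqI[OF b])
qed

text \<open>
  As \<open>q\<close> is a root of its own real quadratic, \<open>Q\<^sub>s(q)\<close> reduces to degree one in \<open>q\<close>; in particular it
  is a paravector, and inverting it needs only its conjugate.
\<close>

lemma Q_para_affine:
  assumes "q \<in> paravectors"
  shows "Q_para s q = (2 * (para_re q - para_re s)) *\<^sub>R q
    + of_real ((para_norm s)\<^sup>2 - (para_norm q)\<^sup>2)"
  by (simp add: Q_para_def paravector_square[OF assms] algebra_simps)

lemma Q_para_in_paravectors: "q \<in> paravectors \<Longrightarrow> Q_para s q \<in> paravectors"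
  by (simp only: Q_para_affine paravectors_add_real)

lemma para_classD:
  assumes "q \<in> para_class s"
  shows "para_re q = para_re s" "para_norm (para_vec q) = para_norm (para_vec s)"
proof -
  let ?N = "para_norm (para_vec s)"
  obtain x where x: "(\<Sum>l\<in>UNIV. (x l)\<^sup>2) = (1 :: real)"
    and q: "q = of_real (para_re s) + ?N *\<^sub>R (\<Sum>l\<in>UNIV. x l *\<^sub>R gen l)"
    using assms unfolding para_class_def unit_sphere_def by blast
  show "para_re q = para_re s"
    by (simp add: q para_re_def)
  have "(para_norm (para_vec q))\<^sup>2 = (\<Sum>l\<in>UNIV. (?N * x l)\<^sup>2)"
    by (simp add: para_norm_para_vec_square q)
  also have "\<dots> = ?N\<^sup>2"
    by (simp add: power_mult_distrib x flip: sum_distrib_left)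
  finally show "para_norm (para_vec q) = ?N"
    by (simp add: para_norm_def sum_nonneg)
qed

text \<open>
  The direction of \<open>\<underline>q\<close> serves as the imaginary unit \<open>j\<close>; when \<open>\<underline>q = 0\<close> any unit vector does, and one
  exists because there is at least one generator.
\<close>

lemma para_classI:
  fixes s q :: "'n::{finite,linorder} clifford"
  assumes q: "q \<in> paravectors"
    and re: "para_re q = para_re s"
    and vec: "para_norm (para_vec q) = para_norm (para_vec s)"
  shows "q \<in> para_class s"
proof -
  let ?N = "para_norm (para_vec q)"
  obtain j where j: "j \<in> unit_sphere" "para_vec q = ?N *\<^sub>R j"
  proof (cases "?N = 0")
    case True
    then have "cl_coeff q {l} = 0" for l
      using para_norm_para_vec_square[of q] by (simp add: sum_nonneg_eq_0_iff)
    then have "para_vec q = 0"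
      by (simp add: para_vec_def)
    moreover have "(\<Sum>l\<in>UNIV. (if l = m then 1 else 0) *\<^sub>R gen l) \<in> unit_sphere" for m :: 'n
      unfolding unit_sphere_def
      by (intro CollectI exI[of _ "\<lambda>l. if l = m then 1 else 0"])
        (simp add: if_distrib[of "\<lambda>u. u\<^sup>2"] cong: if_cong)
    ultimately show ?thesis
      using True by (intro that[rotated]) simp_all
  next
    case False
    let ?x = "\<lambda>l. cl_coeff q {l} / ?N"
    have "(\<Sum>l\<in>UNIV. (?x l)\<^sup>2) = (\<Sum>l\<in>UNIV. (cl_coeff q {l})\<^sup>2) / ?N\<^sup>2"
      by (simp add: power_divide sum_divide_distrib)
    also have "\<dots> = 1"
      using False by (simp flip: para_norm_para_vec_square)
    finally have "(\<Sum>l\<in>UNIV. ?x l *\<^sub>R gen l) \<in> unit_sphere"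
      unfolding unit_sphere_def by (intro CollectI exI[of _ ?x] conjI refl)
    moreover have "para_vec q = ?N *\<^sub>R (\<Sum>l\<in>UNIV. ?x l *\<^sub>R gen l)"
      using False by (simp add: para_vec_def scaleR_sum_right)
    ultimately show ?thesis
      by (rule that)
  qed
  have "q = of_real (para_re q) + para_vec q"
    by (rule paravector_decomp[OF q, symmetric])
  also have "\<dots> = of_real (para_re s) + para_norm (para_vec s) *\<^sub>R j"
    unfolding re by (subst j(2)) (simp only: vec)
  finally have "q = of_real (para_re s) + para_norm (para_vec s) *\<^sub>R j" .
  with j(1) show ?thesis
    unfolding para_class_def by blast
qed

lemma para_class_sym:
  assumes "s \<in> paravectors" "q \<in> para_class s"
  shows "s \<in> para_class q"
  using assms para_classD[of q s] para_classI[of s q] by simp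

text \<open>
  The two vanishing conditions are those on the real part,
  \<open>(Re(q) - Re(s))\<^sup>2 + \<bar>\<underline>s\<bar>\<^sup>2 = \<bar>\<underline>q\<bar>\<^sup>2\<close>, and on the vector part, \<open>(Re(q) - Re(s)) \<underline>q = 0\<close>.
  If the real parts differed, the second would force \<open>\<underline>q = 0\<close>, against the first.
\<close>

lemma para_norm_Q_para_nonzero:
  assumes q: "q \<in> paravectors" and notin: "q \<notin> para_class s"
  shows "para_norm (Q_para s q) \<noteq> 0"
proof
  assume "para_norm (Q_para s q) = 0"
  then have "(para_re (Q_para s q))\<^sup>2 + (\<Sum>l\<in>UNIV. (cl_coeff (Q_para s q) {l})\<^sup>2) = 0"
    using para_norm_square[of "Q_para s q"] by simp
  then have zero: "para_re (Q_para s q) = 0" "\<And>l. cl_coeff (Q_para s q) {l} = 0"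
    by (simp_all add: add_nonneg_eq_0_iff sum_nonneg sum_nonneg_eq_0_iff)
  let ?d = "para_re q - para_re s"
  have re: "?d\<^sup>2 + (para_norm (para_vec s))\<^sup>2 = (para_norm (para_vec q))\<^sup>2"
  proof -
    have norm: "(para_norm a)\<^sup>2 = (para_re a)\<^sup>2 + (para_norm (para_vec a))\<^sup>2" for a :: "'a clifford"
      by (simp only: para_norm_square[of a] para_norm_para_vec_square)
    have "2 * ?d * para_re q + ((para_norm s)\<^sup>2 - (para_norm q)\<^sup>2) = 0"
      using zero(1)
      by (simp add: Q_para_affine[OF q] para_re_def del: of_real_diff of_real_power)
    then show ?thesis
      unfolding norm[of s] norm[of q] by (simp add: power2_eq_square algebra_simps)
  qed
  have "?d * cl_coeff q {l} = 0" for l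
    using zero(2)[of l] by (simp add: Q_para_affine[OF q] del: of_real_diff of_real_power)
  then have "?d = 0 \<or> (\<Sum>l\<in>UNIV. (cl_coeff q {l})\<^sup>2) = 0"
    by (cases "?d = 0") simp_all
  then have "?d = 0 \<or> para_norm (para_vec q) = 0"
    unfolding para_norm_para_vec_square[symmetric] by simp
  then have d: "?d = 0"
    using re by (auto simp: sum_power2_eq_zero_iff)
  then have "para_norm (para_vec q) = para_norm (para_vec s)"
    using re by (simp add: para_norm_def sum_nonneg)
  with d show False
    using para_classI[OF q] notin by simp
qed


section \<open>Clifford numbers as operators\<close>

lemma cl_act_nth: "cl_act a w $ C = (\<Sum>A\<in>UNIV. cl_coeff (a * blade A) C *\<^sub>R w $ A)"
  by (simp add: cl_act_def cl_tensor_def)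

text \<open>Associativity of \<open>\<real>\<^sub>n\<close>, read on each basis element \<open>e\<^sub>D\<close>: expand \<open>b e\<^sub>D\<close> in blades.\<close>

lemma cl_act_mult: "cl_act (a * b) w = cl_act a (cl_act b w)"
proof -
  have "cl_act (a * b) w $ C = cl_act a (cl_act b w) $ C" for C
  proof -
    have "a * b * blade D = (\<Sum>A\<in>UNIV. cl_coeff (b * blade D) A *\<^sub>R (a * blade A))" for D
      by (subst mult.assoc, subst clifford_expand[of "b * blade D"]) (simp add: sum_distrib_left)
    then have "cl_act (a * b) w $ C
        = (\<Sum>D\<in>UNIV. \<Sum>A\<in>UNIV. (cl_coeff (b * blade D) A * cl_coeff (a * blade A) C) *\<^sub>R w $ D)"
      by (simp add: cl_act_nth cl_coeff_sum scaleR_sum_left)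
    also have "\<dots> = cl_act a (cl_act b w) $ C"
      by (subst sum.swap) (simp add: cl_act_nth scaleR_sum_right mult.commute)
    finally show ?thesis .
  qed
  then show ?thesis
    by (simp add: vec_eq_iff)
qed

lemma cl_act_add: "cl_act (a + b) w = cl_act a w + cl_act b w"
  by (simp add: vec_eq_iff cl_act_nth distrib_right scaleR_add_left sum.distrib)

lemma cl_act_scaleR: "cl_act (r *\<^sub>R a) w = r *\<^sub>R cl_act a w"
  by (simp add: vec_eq_iff cl_act_nth scaleR_sum_right)

lemma cl_act_one: "cl_act 1 w = w"
proof -
  have "(\<Sum>A\<in>UNIV. (if C = A then 1 else 0 :: real) *\<^sub>R w $ A) = w $ C" for C
    by (simp add: if_distrib[of "\<lambda>u. u *\<^sub>R _"] cong: if_cong)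
  then show ?thesis
    by (simp add: vec_eq_iff cl_act_nth)
qed

lemma cl_act_of_real: "cl_act (of_real r) w = r *\<^sub>R w"
  by (simp add: of_real_def cl_act_scaleR cl_act_one)

lemma cl_act_diff: "cl_act (a - b) w = cl_act a w - cl_act b w"
  by (metis cl_act_add add_diff_cancel_right' diff_add_cancel)

lemma cl_act_linear_simps:
  "cl_act a (v + w) = cl_act a v + cl_act a w"
  "cl_act a (v - w) = cl_act a v - cl_act a w"
  "cl_act a (- v) = - cl_act a v"
  "cl_act a (r *\<^sub>R v) = r *\<^sub>R cl_act a v"
  for v w :: "('v::banach, 'n::{finite,linorder}) clmod"
proof -
  interpret bounded_linear "cl_act a :: ('v, 'n) clmod \<Rightarrow> _"
    by (rule bounded_linear_cl_act)
  show "cl_act a (v + w) = cl_act a v + cl_act a w" "cl_act a (v - w) = cl_act a v - cl_act a w"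
    "cl_act a (- v) = - cl_act a v" "cl_act a (r *\<^sub>R v) = r *\<^sub>R cl_act a v"
    by (rule add diff neg scaleR)+
qed

lemma cl_op_left_minus: "cl_op_left a (- T) = - cl_op_left a T"
  by (rule blinfun_eqI) (simp add: cl_op_left_apply blinfun.bilinear_simps cl_act_linear_simps)

lemma cl_op_right_minus: "cl_op_right (- T) a = - cl_op_right T a"
  by (rule blinfun_eqI) (simp add: cl_op_right_apply blinfun.bilinear_simps)


section \<open>The S-resolvent equations\<close>

lemma clop_inverse_compose:
  assumes "clop_invertible T"
  shows "clop_inverse T o\<^sub>L T = id_blinfun" "T o\<^sub>L clop_inverse T = id_blinfun"
proof -
  have "\<exists>!S. S \<in> clifford_ops \<and> S o\<^sub>L T = id_blinfun \<and> T o\<^sub>L S = id_blinfun"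
  proof (rule ex_ex1I)
    show "\<exists>S. S \<in> clifford_ops \<and> S o\<^sub>L T = id_blinfun \<and> T o\<^sub>L S = id_blinfun"
      using assms by (auto simp: clop_invertible_def)
  next
    fix S S'
    assume "S \<in> clifford_ops \<and> S o\<^sub>L T = id_blinfun \<and> T o\<^sub>L S = id_blinfun"
      and "S' \<in> clifford_ops \<and> S' o\<^sub>L T = id_blinfun \<and> T o\<^sub>L S' = id_blinfun"
    then have "S (T (S' v)) = S v" "S (T (S' v)) = S' v" for v
      by (metis blinfun_apply_blinfun_compose blinfun_apply_id_blinfun)+
    then show "S = S'"
      by (intro blinfun_eqI) simp
  qed
  from theI'[OF this] show "clop_inverse T o\<^sub>L T = id_blinfun" "T o\<^sub>L clop_inverse T = id_blinfun"
    by (simp_all add: clop_inverse_def)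
qed

lemma Q_op_inverse:
  assumes "s \<in> S_resolvent_set T"
  shows "clop_inverse (Q_op s T) (Q_op s T v) = v"
    and "Q_op s T (clop_inverse (Q_op s T) v) = v"
    and "T (clop_inverse (Q_op s T) v) = clop_inverse (Q_op s T) (T v)"
proof -
  let ?P = "clop_inverse (Q_op s T)"
  have "clop_invertible (Q_op s T)"
    using assms by (simp add: S_resolvent_set_def)
  from clop_inverse_compose[OF this] show inv: "?P (Q_op s T v) = v" "Q_op s T (?P v) = v" for v
    by (metis blinfun_apply_blinfun_compose blinfun_apply_id_blinfun)+
  have "Q_op s T (T v) = T (Q_op s T v)" for v
    by (simp add: Q_op_def blinfun.bilinear_simps)
  then show "T (?P v) = ?P (T v)"
    by (metis inv)
qed

text \<open>
  In \<open>(T - q\<^sup>*) q - T (T - q\<^sup>*)\<close> no scalar stands to the left of \<open>T\<close>. The scalars occur only through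
  \<open>T (q + q\<^sup>*)\<close> and \<open>q\<^sup>* q\<close>, which are real multiples of \<open>T\<close> and of the identity, although \<open>q\<close> alone
  does not commute with \<open>T\<close>.
\<close>

lemma left_S_resolvent_equation:
  assumes "q \<in> S_resolvent_set T"
  shows "S_L_inv q T (cl_act q v) - T (S_L_inv q T v) = v"
proof -
  let ?P = "clop_inverse (Q_op q T)"
  have q: "q \<in> paravectors"
    using assms by (simp add: S_resolvent_set_def)
  have conj: "cl_act (para_conj q) w = (2 * para_re q) *\<^sub>R w - cl_act q w" for w
    by (simp add: para_conj_paravector[OF q] cl_act_diff cl_act_of_real del: of_real_mult)
  have norm: "cl_act (para_conj q) (cl_act q v) = (para_norm q)\<^sup>2 *\<^sub>R v"
    by (simp add: para_conj_mult[OF q] cl_act_of_real del: of_real_power flip: cl_act_mult)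
  have "S_L_inv q T (cl_act q v) - T (S_L_inv q T v)
      = ?P (T (T v - cl_act (para_conj q) v) - (T (cl_act q v) - cl_act (para_conj q) (cl_act q v)))"
    by (simp add: S_L_inv_def cl_op_left_apply blinfun.bilinear_simps Q_op_inverse(3)[OF assms])
  also have "\<dots> = ?P (Q_op q T v)"
    unfolding norm by (simp add: conj Q_op_def blinfun.bilinear_simps)
  also have "\<dots> = v"
    by (rule Q_op_inverse(1)[OF assms])
  finally show ?thesis .
qed

text \<open>Here the scalars must stand to the left of \<open>T\<close>, in \<open>(s + s\<^sup>*) T\<close> and \<open>s s\<^sup>*\<close>.\<close>

lemma right_S_resolvent_equation:
  assumes "s \<in> S_resolvent_set T"
  shows "cl_act s (S_R_inv s T v) - S_R_inv s T (T v) = v"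
proof -
  let ?P = "clop_inverse (Q_op s T)"
  have s: "s \<in> paravectors"
    using assms by (simp add: S_resolvent_set_def)
  have conj: "cl_act (para_conj s) w = (2 * para_re s) *\<^sub>R w - cl_act s w" for w
    by (simp add: para_conj_paravector[OF s] cl_act_diff cl_act_of_real del: of_real_mult)
  have norm: "cl_act s (cl_act (para_conj s) w) = (para_norm s)\<^sup>2 *\<^sub>R w" for w
    by (simp add: para_mult_conj[OF s] cl_act_of_real del: of_real_power flip: cl_act_mult)
  have "cl_act s (S_R_inv s T v) - S_R_inv s T (T v)
      = T (T (?P v)) - cl_act (para_conj s) (T (?P v))
        - (cl_act s (T (?P v)) - cl_act s (cl_act (para_conj s) (?P v)))"
    by (simp add: S_R_inv_def cl_op_left_apply blinfun.bilinear_simps cl_act_linear_simps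
        Q_op_inverse(3)[OF assms])
  also have "\<dots> = Q_op s T (?P v)"
    unfolding norm by (simp add: conj Q_op_def blinfun.bilinear_simps)
  also have "\<dots> = v"
    by (rule Q_op_inverse(2)[OF assms])
  finally show ?thesis .
qed

text \<open>
  The left and right multiplications by \<open>s\<close> and \<open>q\<close> commute with each other as maps on operators, and
  each satisfies the real quadratic equation of its paravector. Hence the map \<open>X \<mapsto> X q - s X\<close> has a
  conjugate, \<open>D \<mapsto> D q - s\<^sup>* D\<close>, whose composition with it is multiplication by \<open>Q\<^sub>s(q)\<close> from the right.
  Conjugating \<open>q\<close> instead of \<open>s\<close> eliminates \<open>q\<close> in favour of its real part and norm, and leaves
  \<open>Q\<^sub>q(s)\<close> on the left.
\<close>

lemma sylvester_solution:
  fixes X D :: "('v::banach, 'n::{finite,linorder}) clmap"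
  assumes s: "s \<in> paravectors" and q: "q \<in> paravectors"
    and D: "D = cl_op_right X q - cl_op_left s X"
  shows "cl_op_right D q - cl_op_left (para_conj s) D = cl_op_right X (Q_para s q)"
    and "cl_op_left s D - cl_op_right D (para_conj q) = - cl_op_left (Q_para q s) X"
proof -
  have s': "cl_act (para_conj s) (cl_act s v) = (para_norm s)\<^sup>2 *\<^sub>R v"
    and q': "cl_act q (cl_act (para_conj q) v) = (para_norm q)\<^sup>2 *\<^sub>R v"
    for v :: "('v, 'n) clmod"
    by (simp_all add: para_conj_mult[OF s] para_mult_conj[OF q] cl_act_of_real del: of_real_power
        flip: cl_act_mult)
  have conj: "cl_act (para_conj a) v = (2 * para_re a) *\<^sub>R v - cl_act a v"
    if "a \<in> paravectors" for a :: "'n clifford" and v :: "('v, 'n) clmod"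
    by (simp add: para_conj_paravector[OF that] cl_act_diff cl_act_of_real del: of_real_mult)
  have Q: "cl_act (Q_para a b) v = cl_act b (cl_act b v) - (2 * para_re a) *\<^sub>R cl_act b v
      + (para_norm a)\<^sup>2 *\<^sub>R v"
    for a b :: "'n clifford" and v :: "('v, 'n) clmod"
    by (simp add: Q_para_def cl_act_add cl_act_diff cl_act_scaleR cl_act_of_real power2_eq_square
        cl_act_mult del: of_real_mult)
  have D_apply: "D v = X (cl_act q v) - cl_act s (X v)" for v
    by (simp add: D blinfun.bilinear_simps cl_op_left_apply cl_op_right_apply)
  show "cl_op_right D q - cl_op_left (para_conj s) D = cl_op_right X (Q_para s q)"
    by (rule blinfun_eqI)
      (simp add: blinfun.bilinear_simps cl_op_left_apply cl_op_right_apply D_apply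
        cl_act_linear_simps s' Q conj[OF s, of "X _"])
  show "cl_op_left s D - cl_op_right D (para_conj q) = - cl_op_left (Q_para q s) X"
    \<comment> \<open>The product \<open>q q\<^sup>*\<close> has to be evaluated before \<open>q\<^sup>*\<close> is replaced by \<open>2 Re(q) - q\<close>.\<close>
    by (rule blinfun_eqI, simp add: blinfun.bilinear_simps cl_op_left_apply cl_op_right_apply
        D_apply cl_act_linear_simps q' Q)
      (simp add: conj[OF q] blinfun.bilinear_simps cl_act_linear_simps)
qed

text \<open>
  The left resolvent equation, used under \<open>R B\<close>, turns \<open>X q\<close> into \<open>R B + R B T L\<close>; the right one, used
  after \<open>B\<close> has passed \<open>T\<close>, turns \<open>R T B L\<close> into \<open>s X - B L\<close>.
\<close>

lemma S_resolvent_product_sylvester: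
  assumes BT: "B o\<^sub>L T = T o\<^sub>L B"
    and s: "s \<in> S_resolvent_set T" and q: "q \<in> S_resolvent_set T"
  defines "X \<equiv> S_R_inv s T o\<^sub>L B o\<^sub>L S_L_inv q T"
  shows "(S_R_inv s T o\<^sub>L B) - (B o\<^sub>L S_L_inv q T) = cl_op_right X q - cl_op_left s X"
proof (rule blinfun_eqI)
  fix v
  let ?R = "S_R_inv s T" and ?L = "S_L_inv q T"
  have BT': "B (T w) = T (B w)" for w
    using BT by (metis blinfun_apply_blinfun_compose)
  have "X (cl_act q v) = ?R (B (v + T (?L v)))"
    using left_S_resolvent_equation[OF q, of v] by (simp add: X_def algebra_simps)
  also have "\<dots> = ?R (B v) + ?R (T (B (?L v)))"
    by (simp add: blinfun.bilinear_simps BT')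
  also have "\<dots> = ?R (B v) + (cl_act s (X v) - B (?L v))"
    using right_S_resolvent_equation[OF s, of "B (?L v)"] by (simp add: X_def algebra_simps)
  finally show "((?R o\<^sub>L B) - (B o\<^sub>L ?L)) v = (cl_op_right X q - cl_op_left s X) v"
    by (simp add: blinfun.bilinear_simps cl_op_left_apply cl_op_right_apply)
qed


section \<open>The product of a right and a left S-resolvent\<close>

theorem theorem6p7:
  fixes T B :: "('v::banach, 'n::{finite,linorder}) clmap"
    and s q :: "'n clifford"
  assumes "T \<in> paravector_ops"
    and "B \<in> clifford_ops"
    and "B o\<^sub>L T = T o\<^sub>L B"
    and "s \<in> S_resolvent_set T"
    and "q \<in> S_resolvent_set T"
    and "q \<notin> para_class s"
  shows "S_R_inv s T o\<^sub>L B o\<^sub>L S_L_inv q T =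
      cl_op_right
        (cl_op_right ((S_R_inv s T o\<^sub>L B) - (B o\<^sub>L S_L_inv q T)) q
          - cl_op_left (para_conj s) ((S_R_inv s T o\<^sub>L B) - (B o\<^sub>L S_L_inv q T)))
        (cl_inverse (Q_para s q))
    \<and> S_R_inv s T o\<^sub>L B o\<^sub>L S_L_inv q T =
      - cl_op_left (cl_inverse (Q_para q s))
        (cl_op_right ((B o\<^sub>L S_L_inv q T) - (S_R_inv s T o\<^sub>L B)) (para_conj q)
          - cl_op_left s ((B o\<^sub>L S_L_inv q T) - (S_R_inv s T o\<^sub>L B)))"
proof -
  have s: "s \<in> paravectors" and q: "q \<in> paravectors"
    using assms by (simp_all add: S_resolvent_set_def)
  let ?X = "S_R_inv s T o\<^sub>L B o\<^sub>L S_L_inv q T"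
  define D where "D = (S_R_inv s T o\<^sub>L B) - (B o\<^sub>L S_L_inv q T)"
  have D': "(B o\<^sub>L S_L_inv q T) - (S_R_inv s T o\<^sub>L B) = - D"
    by (simp add: D_def)
  have D: "D = cl_op_right ?X q - cl_op_left s ?X"
    unfolding D_def by (rule S_resolvent_product_sylvester[OF assms(3-5)])
  note syl = sylvester_solution[OF s q D]
  have "Q_para s q * cl_inverse (Q_para s q) = 1"
    using q assms(6) by (intro paravector_cl_inverse Q_para_in_paravectors para_norm_Q_para_nonzero)
  then have "?X = cl_op_right (cl_op_right ?X (Q_para s q)) (cl_inverse (Q_para s q))"
    by (intro blinfun_eqI) (simp add: cl_op_right_apply cl_act_one flip: cl_act_mult)
  moreover have "s \<notin> para_class q"
    using para_class_sym[OF q] assms(6) by blast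
  then have "cl_inverse (Q_para q s) * Q_para q s = 1"
    using s by (intro paravector_cl_inverse Q_para_in_paravectors para_norm_Q_para_nonzero)
  then have "?X = cl_op_left (cl_inverse (Q_para q s)) (cl_op_left (Q_para q s) ?X)"
    by (intro blinfun_eqI) (simp add: cl_op_left_apply cl_act_one flip: cl_act_mult)
  moreover have "cl_op_right (- D) (para_conj q) - cl_op_left s (- D) = - cl_op_left (Q_para q s) ?X"
    using syl(2) by (simp add: cl_op_right_minus cl_op_left_minus)
  ultimately show ?thesis
    unfolding D' D_def[symmetric] syl(1) by (simp add: cl_op_left_minus)
qed

end
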